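(* Let $G$ be a group satisfying the following properties: (1) $G=\langle G_1,G_2,G_3\rangle$ for subgroups $G_1,G_2,G_3$ of $G$ such that each pair $G_i,G_j$ generates a finite group $G_{i,j}=\langle G_i,G_j\rangle$ ($1\le i\ne j\le 3$). (2) For all $1\le i\neq j\le 3$ and any orthogonal representation $(\pi,\mathcal{H})$ of the group $G_{i,j}$, every $v\in\mathcal{H}$ with $v\notin\mathcal{H}^{G_{i,j}}$ satisfies $$d_0^2(v)<2\bigl(d_i^2(v)+d_j^2(v)\bigr),$$ where $d_0(v)$ denotes the distance of $v$ from the closed subspace $\mathcal{H}^{G_{i,j}}$ of $G_{i,j}$-invariant vectors, and $d_i(v)$, $d_j(v)$ denote the distances of $v$ from $\mathcal{H}^{G_i}$ and $\mathcal{H}^{G_j}$ respectively. Then $G$ has property FH.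
   Context: An orthogonal representation is a representation by linear isometries on a real Hilbert space; for a subgroup $K$, $\mathcal{H}^K$ denotes the closed subspace of $K$-invariant vectors. A group $G$ has property FH if every affine isometric action of $G$ on a Hilbert space has a fixed point. *)

theory Defs
  imports
    "HOL-Analysis.Analysis"
    "HOL-Algebra.Module"
    "HOL-Algebra.Generated_Groups"
    "HOL-Algebra.Group_Action"
begin

section \<open>Real Hilbert spaces as objects\<close>

text \<open>
  The hypothesis of the theorem quantifies over all real Hilbert spaces.  Quantification over types
  is not available inside a formula, so there a Hilbert space is a record whose carrier is a subset
  of a type, with its own operations.
\<close>

definition real_ring :: "real ring" where
  "real_ring = \<lparr>carrier = UNIV, mult = (*), one = 1, zero = 0, add = (+)\<rparr>"

record 'h ip_space = "(real, 'h) module" +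
  ip :: "'h \<Rightarrow> 'h \<Rightarrow> real"

definition hnorm :: "('h, 'm) ip_space_scheme \<Rightarrow> 'h \<Rightarrow> real" where
  "hnorm H x = sqrt (ip H x x)"

definition hdist :: "('h, 'm) ip_space_scheme \<Rightarrow> 'h \<Rightarrow> 'h \<Rightarrow> real" where
  "hdist H x y = hnorm H (x \<ominus>\<^bsub>H\<^esub> y)"

definition hsetdist :: "('h, 'm) ip_space_scheme \<Rightarrow> 'h \<Rightarrow> 'h set \<Rightarrow> real" where
  "hsetdist H v S = (INF w\<in>S. hdist H v w)"

locale hilbert_space = module real_ring H for H :: "('h, 'm) ip_space_scheme" (structure) +
  assumes ip_sym: "x \<in> carrier H \<Longrightarrow> y \<in> carrier H \<Longrightarrow> ip H x y = ip H y x"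
    and ip_add: "x \<in> carrier H \<Longrightarrow> y \<in> carrier H \<Longrightarrow> z \<in> carrier H \<Longrightarrow>
      ip H (x \<oplus> y) z = ip H x z + ip H y z"
    and ip_smult: "x \<in> carrier H \<Longrightarrow> y \<in> carrier H \<Longrightarrow> ip H (a \<odot> x) y = a * ip H x y"
    and ip_nonneg: "x \<in> carrier H \<Longrightarrow> 0 \<le> ip H x x"
    and ip_definite: "x \<in> carrier H \<Longrightarrow> ip H x x = 0 \<Longrightarrow> x = \<zero>"
    and complete: "range \<sigma> \<subseteq> carrier H \<Longrightarrow>
      \<forall>\<epsilon>>0. \<exists>N. \<forall>m\<ge>N. \<forall>n\<ge>N. hdist H (\<sigma> m) (\<sigma> n) < \<epsilon> \<Longrightarrow>
      \<exists>x\<in>carrier H. (\<lambda>n. hdist H (\<sigma> n) x) \<longlonglongrightarrow> 0"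

text \<open>
  Every Hilbert space in the type class sense is an instance.  The ring fields \<open>mult\<close> and \<open>one\<close>
  that a module record inherits are irrelevant.
\<close>

definition type_hilbert :: "'h::{real_inner, complete_space} ip_space" where
  "type_hilbert = \<lparr>carrier = UNIV, mult = (\<lambda>_ _. 0), one = 0, zero = 0, add = (+),
     smult = (*\<^sub>R), ip = inner\<rparr>"

lemma abelian_group_type_hilbert:
  "abelian_group (type_hilbert :: 'h::{real_inner, complete_space} ip_space)"
proof (rule abelian_groupI)
  fix x :: 'h
  show "\<exists>y\<in>carrier type_hilbert. y \<oplus>\<^bsub>type_hilbert\<^esub> x = \<zero>\<^bsub>type_hilbert\<^esub>"
    by (rule bexI[of _ "- x"]) (simp_all add: type_hilbert_def)
qed (simp_all add: type_hilbert_def add.assoc add.commute)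

lemma a_minus_type_hilbert:
  "x \<ominus>\<^bsub>type_hilbert\<^esub> y = (x - y :: 'h::{real_inner, complete_space})"
proof -
  interpret abelian_group "type_hilbert :: 'h ip_space"
    by (rule abelian_group_type_hilbert)
  have "\<ominus>\<^bsub>type_hilbert\<^esub> y = - y"
    by (rule minus_equality) (simp_all add: type_hilbert_def)
  then show ?thesis
    by (simp add: a_minus_def type_hilbert_def)
qed

lemma hdist_type_hilbert: "hdist type_hilbert x y = dist x y"
  unfolding hdist_def hnorm_def a_minus_type_hilbert
  by (simp add: type_hilbert_def dist_norm norm_eq_sqrt_inner)

lemma hilbert_space_type_hilbert:
  "hilbert_space (type_hilbert :: 'h::{real_inner, complete_space} ip_space)"
proof -
  have "abelian_group real_ring"
  proof (rule abelian_groupI)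
    fix x :: real
    show "\<exists>y\<in>carrier real_ring. y \<oplus>\<^bsub>real_ring\<^esub> x = \<zero>\<^bsub>real_ring\<^esub>"
      by (rule bexI[of _ "- x"]) (simp_all add: real_ring_def)
  qed (simp_all add: real_ring_def)
  moreover have "comm_monoid real_ring"
    by (rule comm_monoidI) (simp_all add: real_ring_def)
  ultimately have R: "cring real_ring"
    by (rule cringI) (simp add: real_ring_def distrib_right)
  have "module real_ring (type_hilbert :: 'h ip_space)"
    using R abelian_group_type_hilbert
    by (rule moduleI) (simp_all add: type_hilbert_def real_ring_def scaleR_add_left scaleR_add_right)
  then show ?thesis
  proof (rule hilbert_space.intro, unfold_locales)
    fix \<sigma> :: "nat \<Rightarrow> 'h"
    assume "\<forall>\<epsilon>>0. \<exists>N. \<forall>m\<ge>N. \<forall>n\<ge>N. hdist type_hilbert (\<sigma> m) (\<sigma> n) < \<epsilon>"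
    then have "Cauchy \<sigma>"
      by (simp add: Cauchy_def hdist_type_hilbert)
    then obtain x where "\<sigma> \<longlonglongrightarrow> x"
      by (meson Cauchy_convergent convergent_def)
    then have "(\<lambda>n. hdist type_hilbert (\<sigma> n) x) \<longlonglongrightarrow> 0"
      unfolding hdist_type_hilbert by (rule tendsto_dist_iff[THEN iffD1])
    then show "\<exists>x\<in>carrier type_hilbert. (\<lambda>n. hdist type_hilbert (\<sigma> n) x) \<longlonglongrightarrow> 0"
      by (rule bexI) (simp add: type_hilbert_def)
  qed (auto simp: type_hilbert_def inner_add_left intro: inner_commute)
qed


section \<open>Orthogonal representations\<close>

definition orthogonal_rep ::
  "('g, 'n) monoid_scheme \<Rightarrow> ('h, 'm) ip_space_scheme \<Rightarrow> ('g \<Rightarrow> 'h \<Rightarrow> 'h) \<Rightarrow> bool" where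
  "orthogonal_rep \<Gamma> H \<pi> \<longleftrightarrow> hilbert_space H \<and> group_action \<Gamma> (carrier H) \<pi> \<and>
     (\<forall>g\<in>carrier \<Gamma>.
        (\<forall>x\<in>carrier H. \<forall>y\<in>carrier H. \<pi> g (x \<oplus>\<^bsub>H\<^esub> y) = \<pi> g x \<oplus>\<^bsub>H\<^esub> \<pi> g y) \<and>
        (\<forall>a. \<forall>x\<in>carrier H. \<pi> g (a \<odot>\<^bsub>H\<^esub> x) = a \<odot>\<^bsub>H\<^esub> \<pi> g x) \<and>
        (\<forall>x\<in>carrier H. hnorm H (\<pi> g x) = hnorm H x))"

definition fixed_vectors ::
  "('h, 'm) ip_space_scheme \<Rightarrow> ('g \<Rightarrow> 'h \<Rightarrow> 'h) \<Rightarrow> 'g set \<Rightarrow> 'h set" where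
  "fixed_vectors H \<pi> K = {v \<in> carrier H. \<forall>g\<in>K. \<pi> g v = v}"


section \<open>Property FH\<close>

definition affine_isometry :: "('h::real_normed_vector \<Rightarrow> 'h) \<Rightarrow> bool" where
  "affine_isometry f \<longleftrightarrow>
     (\<exists>A b. linear A \<and> (\<forall>x. norm (A x) = norm x) \<and> (\<forall>x. f x = A x + b))"

text \<open>
  Property FH with respect to the Hilbert space \<open>'h\<close>; property FH is this statement for all \<open>'h\<close>,
  which is what a theorem with \<open>'h\<close> as a free type variable in the conclusion asserts.
\<close>

definition property_FH ::
  "('g, 'n) monoid_scheme \<Rightarrow> 'h::{real_inner, complete_space} itself \<Rightarrow> bool" where
  "property_FH G _ \<longleftrightarrow>
     (\<forall>\<alpha> :: 'g \<Rightarrow> 'h \<Rightarrow> 'h.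
        group_action G UNIV \<alpha> \<and> (\<forall>g\<in>carrier G. affine_isometry (\<alpha> g)) \<longrightarrow>
        (\<exists>x. \<forall>g\<in>carrier G. \<alpha> g x = x))"


section \<open>The condition on pairs of subgroups\<close>

text \<open>
  The Hilbert spaces \<open>H\<close> here range over all those carried by subsets of \<open>'h\<close>, with arbitrary
  operations.  If \<open>'h\<close> is itself a nonzero Hilbert space, it has at least the cardinality of the
  continuum, so that up to isomorphism \<open>H\<close> takes every separable value even when \<open>'h\<close> has finite
  dimension.  For finite \<open>\<langle>K, L\<rangle>\<close> nothing is lost compared with all Hilbert spaces: the
  inequality for \<open>v\<close> only involves the finite-dimensional span of the orbit of \<open>v\<close>.
\<close>

definition pair_condition ::
  "('g, 'n) monoid_scheme \<Rightarrow> 'g set \<Rightarrow> 'g set \<Rightarrow> 'h itself \<Rightarrow> bool" where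
  "pair_condition G K L _ \<longleftrightarrow>
     (\<forall>(H :: 'h ip_space) \<pi>.
        orthogonal_rep (G\<lparr>carrier := generate G (K \<union> L)\<rparr>) H \<pi> \<longrightarrow>
        (\<forall>v\<in>carrier H. v \<notin> fixed_vectors H \<pi> (generate G (K \<union> L)) \<longrightarrow>
           (hsetdist H v (fixed_vectors H \<pi> (generate G (K \<union> L))))\<^sup>2
             < 2 * ((hsetdist H v (fixed_vectors H \<pi> K))\<^sup>2
                  + (hsetdist H v (fixed_vectors H \<pi> L))\<^sup>2)))"

end

theory Submission
  imports Defs
begin

text \<open>
  For an isometric action of \<open>G\<close> and a finite subgroup \<open>K\<close> let \<open>P\<^sub>K x\<close> be the mean of the \<open>K\<close>-orbit
  of \<open>x\<close>, the nearest \<open>K\<close>-fixed point.  The sum \<open>f x\<close> of the squares of the \<open>u\<^sub>i = x - P\<^sub>i x\<close> decreases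
  by a fixed factor when \<open>x\<close> is replaced by the centroid of the three points \<open>P\<^sub>i x\<close>, provided that
  \<open>\<bar>u\<^sub>1 + u\<^sub>2 + u\<^sub>3\<bar>\<^sup>2 \<ge> c f x\<close> with \<open>c > 0\<close>; iterating gives a Cauchy sequence whose limit is
  fixed by \<open>G\<close>.  If \<open>\<bar>x - P\<^sub>i\<^sub>j x\<bar>\<^sup>2 \<le> \<rho> (\<bar>u\<^sub>i\<bar>\<^sup>2 + \<bar>u\<^sub>j\<bar>\<^sup>2)\<close> for all pairs, then
  \<open>\<bar>u\<^sub>i + u\<^sub>j\<bar>\<^sup>2 \<ge> (\<bar>u\<^sub>i\<bar>\<^sup>2 + \<bar>u\<^sub>j\<bar>\<^sup>2) / \<rho>\<close>, and \<open>c = 2 / \<rho> - 1\<close> will do.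

  The hypothesis gives such an inequality only with a strict sign and \<open>\<rho> = 2\<close>.  A uniform \<open>\<rho> < 2\<close>
  comes from compactness of the unit sphere of the regular representation of the finite group
  \<open>G\<^sub>i\<^sub>j\<close>, and the orbit map of \<open>x\<close>, taken coordinatewise, reduces every action to the regular
  representation.
\<close>

section \<open>Quadratic inequalities on a finite group\<close>

text \<open>For subgroups \<open>K\<close> and \<open>F\<close> with \<open>K \<subseteq> F\<close>
  this is the orthogonal projection onto the functions on \<open>F\<close> that are constant on the
  right cosets of \<open>K\<close>.\<close>

definition translate_avg :: "('g, 'n) monoid_scheme \<Rightarrow> 'g set \<Rightarrow> ('g \<Rightarrow> 'v::real_vector) \<Rightarrow> 'g \<Rightarrow> 'v" where
  "translate_avg G K f g = (\<Sum>k\<in>K. f (inv\<^bsub>G\<^esub> k \<otimes>\<^bsub>G\<^esub> g)) /\<^sub>R real (card K)"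

text \<open>For subgroups \<open>K \<subseteq> F\<close>, the squared l2-distance on
  \<open>F\<close> from \<open>f\<close> to the left \<open>K\<close>-invariant functions. Values
  are vectors because orbit maps of an action are inserted later.\<close>

definition defect :: "('g, 'n) monoid_scheme \<Rightarrow> 'g set \<Rightarrow> 'g set \<Rightarrow> ('g \<Rightarrow> 'v::real_normed_vector) \<Rightarrow> real" where
  "defect G F K f = (\<Sum>g\<in>F. (norm (f g - translate_avg G K f g))\<^sup>2)"

text \<open>Parseval's identity on a finite-dimensional subspace: \<open>C\<close> comes from an
  orthogonal spanning set by dropping a possible zero vector and normalising.\<close>

lemma sum_inner_sq_over_span:
  fixes B :: "'a::real_inner set"
  assumes "finite B"
  obtains C :: "'a set" where "finite C" "\<And>x. x \<in> span B \<Longrightarrow> (norm x)\<^sup>2 = (\<Sum>c\<in>C. (x \<bullet> c)\<^sup>2)"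
proof -
  obtain D where D: "finite D" "span D = span B" "pairwise orthogonal D"
    using basis_orthogonal[OF assms] by blast
  define e :: "'a \<Rightarrow> 'a" where "e d = d /\<^sub>R norm d" for d
  \<comment> \<open>\<open>C\<close> is a set, so normalisation must not merge two basis vectors; a
    common unit vector would be orthogonal to itself.\<close>
  have inj: "inj_on e (D - {0})"
  proof (rule inj_onI, rule ccontr)
    fix c d assume cd: "c \<in> D - {0}" "d \<in> D - {0}" "e c = e d" "c \<noteq> d"
    then have "c \<bullet> d = 0"
      using D(3) by (auto simp: pairwise_def orthogonal_def)
    then have "e c \<bullet> e d = 0"
      by (simp add: e_def)
    then have "e c = 0"
      using cd(3) by simp
    then show False
      using cd by (simp add: e_def)
  qed
  have "(norm x)\<^sup>2 = (\<Sum>c\<in>e ` (D - {0}). (x \<bullet> c)\<^sup>2)" if "x \<in> span B" for x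
  proof -
    have "x \<in> range (\<lambda>u. \<Sum>d\<in>D. u d *\<^sub>R d)"
      using that by (simp flip: D(2) add: span_finite[OF D(1)])
    then obtain u where x: "x = (\<Sum>d\<in>D. u d *\<^sub>R d)"
      by (elim rangeE)
    have xd: "x \<bullet> d = u d * (d \<bullet> d)" if "d \<in> D" for d
    proof -
      have "x \<bullet> d = (\<Sum>c\<in>D. u c * (c \<bullet> d))"
        by (simp add: x inner_sum_left)
      also have "\<dots> = (\<Sum>c\<in>D. if c = d then u d * (d \<bullet> d) else 0)"
        using D(3) that by (intro sum.cong) (auto simp: pairwise_def orthogonal_def)
      finally show ?thesis
        using that D(1) by simp
    qed
    have "(norm x)\<^sup>2 = (\<Sum>d\<in>D. u d * (x \<bullet> d))"
      by (subst power2_norm_eq_inner, subst (2) x) (simp add: inner_sum_right)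
    also have "\<dots> = (\<Sum>d\<in>D - {0}. u d * (x \<bullet> d))"
      using D(1) by (intro sum.mono_neutral_right) auto
    also have "\<dots> = (\<Sum>d\<in>D - {0}. (x \<bullet> e d)\<^sup>2)"
    proof (rule sum.cong[OF refl])
      fix d assume d: "d \<in> D - {0}"
      then have "(x \<bullet> e d)\<^sup>2 = (u d * (d \<bullet> d) / norm d)\<^sup>2"
        by (simp add: e_def xd divide_inverse mult.commute)
      also have "\<dots> = u d * (x \<bullet> d)"
        using d by (simp add: xd power2_eq_square flip: power2_norm_eq_inner)
      finally show "u d * (x \<bullet> d) = (x \<bullet> e d)\<^sup>2" ..
    qed
    finally show ?thesis
      by (simp add: sum.reindex[OF inj])
  qed
  then show thesis
    using D(1) by (intro that) auto
qed

text \<open>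
  A quadratic inequality between real functions on \<open>F\<close> passes to vector-valued functions by summing
  over the coordinates in an orthonormal basis of the span of the values.
\<close>
lemma defect_eq_sum_inner:
  fixes W :: "'g \<Rightarrow> 'h::real_inner"
  assumes "group G" "subgroup F G" "K \<subseteq> F" "finite F"
    and C: "\<And>x. x \<in> span (W ` F) \<Longrightarrow> (norm x)\<^sup>2 = (\<Sum>c\<in>C. (x \<bullet> c)\<^sup>2)"
  shows "defect G F K W = (\<Sum>c\<in>C. defect G F K (\<lambda>g. if g \<in> F then W g \<bullet> c else 0))"
proof -
  interpret group G by fact
  interpret F: subgroup F G by fact
  \<comment> \<open>Averages over \<open>K\<close> only sample points of \<open>F\<close>, so
    cutting the coordinate functions off outside \<open>F\<close> does not affect them
    there.\<close>
  have mem: "inv\<^bsub>G\<^esub> k \<otimes>\<^bsub>G\<^esub> g \<in> F" if "k \<in> K" "g \<in> F" for k g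
    using that assms(3) by auto
  have avg: "translate_avg G K (\<lambda>g. if g \<in> F then W g \<bullet> c else 0) g = translate_avg G K W g \<bullet> c"
    if "g \<in> F" for g c
    using that mem by (simp add: translate_avg_def inner_sum_left)
  have span: "W g - translate_avg G K W g \<in> span (W ` F)" if "g \<in> F" for g
    unfolding translate_avg_def using that mem
    by (intro span_diff span_scale span_sum) (auto intro: span_base)
  have "defect G F K W = (\<Sum>g\<in>F. \<Sum>c\<in>C. ((W g - translate_avg G K W g) \<bullet> c)\<^sup>2)"
    unfolding defect_def by (rule sum.cong[OF refl], rule C, rule span)
  also have "\<dots> = (\<Sum>c\<in>C. \<Sum>g\<in>F. ((W g - translate_avg G K W g) \<bullet> c)\<^sup>2)"
    by (rule sum.swap)
  finally show ?thesis
    by (simp add: defect_def avg inner_diff_left)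
qed

lemma defect_inequality_vector_valued:
  fixes W :: "'g \<Rightarrow> 'h::real_inner"
  assumes "group G" "subgroup F G" "K \<subseteq> F" "L \<subseteq> F" "finite F"
    and scalar: "\<And>v :: 'g \<Rightarrow> real. (\<And>g. g \<notin> F \<Longrightarrow> v g = 0) \<Longrightarrow> (\<Sum>g\<in>F. v g) = 0 \<Longrightarrow>
      (\<Sum>g\<in>F. (v g)\<^sup>2) \<le> \<rho> * (defect G F K v + defect G F L v)"
    and W: "(\<Sum>g\<in>F. W g) = 0"
  shows "(\<Sum>g\<in>F. (norm (W g))\<^sup>2) \<le> \<rho> * (defect G F K W + defect G F L W)"
proof -
  obtain C :: "'h set" where C: "finite C"
      "\<And>x. x \<in> span (W ` F) \<Longrightarrow> (norm x)\<^sup>2 = (\<Sum>c\<in>C. (x \<bullet> c)\<^sup>2)"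
    using sum_inner_sq_over_span[of "W ` F"] \<open>finite F\<close> by blast
  define v where "v c = (\<lambda>g. if g \<in> F then W g \<bullet> c else 0)" for c
  have defect: "defect G F M W = (\<Sum>c\<in>C. defect G F M (v c))" if "M \<subseteq> F" for M
    unfolding v_def using assms that C(2) by (intro defect_eq_sum_inner) auto
  have "(\<Sum>g\<in>F. (norm (W g))\<^sup>2) = (\<Sum>g\<in>F. \<Sum>c\<in>C. (v c g)\<^sup>2)"
    by (simp add: v_def C(2) span_base)
  also have "\<dots> = (\<Sum>c\<in>C. \<Sum>g\<in>F. (v c g)\<^sup>2)"
    by (rule sum.swap)
  \<comment> \<open>Every coordinate of \<open>W\<close> inherits the vanishing sum, so
    \<open>scalar\<close> applies to each \<open>v c\<close>.\<close>
  also have "\<dots> \<le> (\<Sum>c\<in>C. \<rho> * (defect G F K (v c) + defect G F L (v c)))"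
    using W by (intro sum_mono scalar) (auto simp: v_def simp flip: inner_sum_left)
  also have "\<dots> = \<rho> * (defect G F K W + defect G F L W)"
    by (simp add: defect[OF assms(3)] defect[OF assms(4)] sum_distrib_left sum.distrib distrib_left)
  finally show ?thesis .
qed

section \<open>The regular representation\<close>

text \<open>Extension by zero represents each real function on \<open>F\<close> by exactly one total
  function, so that vectors can be compared and encoded injectively.\<close>

definition supported :: "'g set \<Rightarrow> ('g \<Rightarrow> real) set" where
  "supported F = {v. \<forall>g. g \<notin> F \<longrightarrow> v g = 0}"

text \<open>
  The carriers admitted by the pair condition are subsets of one fixed type, so
  \<open>\<real>\<^sup>F\<close> is transported into that type along an arbitrary injection \<open>j\<close>.
\<close>
definition l2_space :: "'g set \<Rightarrow> (('g \<Rightarrow> real) \<Rightarrow> 'h) \<Rightarrow> 'h ip_space" where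
  "l2_space F j = \<lparr>carrier = j ` supported F, mult = (\<lambda>_ _. undefined), one = undefined,
     zero = j (\<lambda>_. 0),
     add = (\<lambda>x y. j (\<lambda>g. inv_into (supported F) j x g + inv_into (supported F) j y g)),
     smult = (\<lambda>a x. j (\<lambda>g. a * inv_into (supported F) j x g)),
     ip = (\<lambda>x y. \<Sum>g\<in>F. inv_into (supported F) j x g * inv_into (supported F) j y g)\<rparr>"

lemma supported_simps [simp]:
  "(\<lambda>_. 0) \<in> supported F"
  "u \<in> supported F \<Longrightarrow> v \<in> supported F \<Longrightarrow> (\<lambda>g. u g + v g) \<in> supported F"
  "u \<in> supported F \<Longrightarrow> v \<in> supported F \<Longrightarrow> (\<lambda>g. u g - v g) \<in> supported F"
  "u \<in> supported F \<Longrightarrow> (\<lambda>g. - u g) \<in> supported F"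
  "u \<in> supported F \<Longrightarrow> (\<lambda>g. a * u g) \<in> supported F"
  "(\<lambda>g. if g \<in> F then w g else 0) \<in> supported F"
  by (auto simp: supported_def)

lemma supported_eqI:
  "u \<in> supported F \<Longrightarrow> v \<in> supported F \<Longrightarrow> (\<And>g. g \<in> F \<Longrightarrow> u g = v g) \<Longrightarrow> u = v"
  unfolding supported_def by fastforce

lemma cring_real_ring: "cring real_ring"
proof -
  have "abelian_group real_ring"
  proof (rule abelian_groupI)
    fix x :: real
    show "\<exists>y\<in>carrier real_ring. y \<oplus>\<^bsub>real_ring\<^esub> x = \<zero>\<^bsub>real_ring\<^esub>"
      by (rule bexI[of _ "- x"]) (simp_all add: real_ring_def)
  qed (simp_all add: real_ring_def)
  moreover have "comm_monoid real_ring"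
    by (rule comm_monoidI) (simp_all add: real_ring_def)
  ultimately show ?thesis
    by (rule cringI) (simp add: real_ring_def distrib_right)
qed

section \<open>The Hilbert space of real functions on a finite set\<close>

locale finite_l2 =
  fixes F :: "'g set" and j :: "('g \<Rightarrow> real) \<Rightarrow> 'h"
  assumes finite_F: "finite F" and inj_j: "inj_on j (supported F)"
begin

abbreviation "H \<equiv> l2_space F j"

lemma carrier_H: "carrier H = j ` supported F"
  by (simp add: l2_space_def)

lemma carrierE:
  assumes "x \<in> carrier H" obtains v where "v \<in> supported F" "x = j v"
  using assms by (auto simp: carrier_H)

lemma j_carrier [simp]: "v \<in> supported F \<Longrightarrow> j v \<in> carrier H"
  by (simp add: carrier_H)

lemma j_eq_iff [simp]: "u \<in> supported F \<Longrightarrow> v \<in> supported F \<Longrightarrow> j u = j v \<longleftrightarrow> u = v"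
  using inj_j by (auto dest: inj_onD)

lemma zero_H: "\<zero>\<^bsub>H\<^esub> = j (\<lambda>_. 0)"
  by (simp add: l2_space_def)

lemma j_simps [simp]:
  assumes "u \<in> supported F"
  shows "v \<in> supported F \<Longrightarrow> j u \<oplus>\<^bsub>H\<^esub> j v = j (\<lambda>g. u g + v g)"
    and "a \<odot>\<^bsub>H\<^esub> j u = j (\<lambda>g. a * u g)"
    and "v \<in> supported F \<Longrightarrow> ip H (j u) (j v) = (\<Sum>g\<in>F. u g * v g)"
  using assms inj_j by (simp_all add: l2_space_def)

lemma abelian_group_H: "abelian_group H"
proof (rule abelian_groupI)
  fix x assume "x \<in> carrier H"
  then obtain v where "v \<in> supported F" "x = j v"
    by (rule carrierE)
  then show "\<exists>y\<in>carrier H. y \<oplus>\<^bsub>H\<^esub> x = \<zero>\<^bsub>H\<^esub>"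
    by (intro bexI[of _ "j (\<lambda>g. - v g)"]) (auto simp: zero_H)
qed (auto simp: zero_H add_ac elim!: carrierE)

lemma j_minus [simp]:
  assumes "u \<in> supported F" "v \<in> supported F"
  shows "j u \<ominus>\<^bsub>H\<^esub> j v = j (\<lambda>g. u g - v g)"
proof -
  interpret abelian_group H
    by (rule abelian_group_H)
  have "\<ominus>\<^bsub>H\<^esub> j v = j (\<lambda>g. - v g)"
    using assms by (intro minus_equality) (auto simp: zero_H)
  then show ?thesis
    using assms by (simp add: a_minus_def)
qed

lemma hnorm_j: "u \<in> supported F \<Longrightarrow> hnorm H (j u) = L2_set u F"
  by (simp add: hnorm_def L2_set_def power2_eq_square)

lemma hdist_j:
  "u \<in> supported F \<Longrightarrow> v \<in> supported F \<Longrightarrow> hdist H (j u) (j v) = L2_set (\<lambda>g. u g - v g) F"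
  by (simp add: hdist_def hnorm_j)

lemma hilbert_space_H: "hilbert_space H"
proof -
  have "module real_ring H"
    by (rule moduleI[OF cring_real_ring abelian_group_H])
      (auto simp: real_ring_def algebra_simps elim!: carrierE)
  then show ?thesis
  proof (rule hilbert_space.intro, unfold_locales)
    fix x assume "x \<in> carrier H" "ip H x x = 0"
    then show "x = \<zero>\<^bsub>H\<^esub>"
      using finite_F by (auto simp: zero_H sum_nonneg_eq_0_iff intro!: supported_eqI[of _ F] elim!: carrierE)
  next
    fix \<sigma> :: "nat \<Rightarrow> 'h"
    assume \<sigma>: "range \<sigma> \<subseteq> carrier H"
      and cauchy: "\<forall>\<epsilon>>0. \<exists>N. \<forall>m\<ge>N. \<forall>n\<ge>N. hdist H (\<sigma> m) (\<sigma> n) < \<epsilon>"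
    have "\<forall>n. \<exists>v. v \<in> supported F \<and> \<sigma> n = j v"
      using \<sigma> by (auto simp: carrier_H)
    then obtain s where s: "\<And>n. s n \<in> supported F" "\<And>n. \<sigma> n = j (s n)"
      by metis
    \<comment> \<open>The norm dominates each of the finitely many coordinates, so completeness
      reduces to that of the reals.\<close>
    have "convergent (\<lambda>n. s n g)" if "g \<in> F" for g
    proof -
      have "\<bar>s m g - s n g\<bar> \<le> hdist H (\<sigma> m) (\<sigma> n)" for m n
        using member_le_L2_set[OF finite_F that, of "\<lambda>g. \<bar>s m g - s n g\<bar>"]
        by (simp add: s hdist_j L2_set_def)
      then have "Cauchy (\<lambda>n. s n g)"
        unfolding Cauchy_def dist_real_def using cauchy by (meson order_le_less_trans)
      then show ?thesis
        by (rule Cauchy_convergent)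
    qed
    then have "\<forall>g\<in>F. \<exists>l. (\<lambda>n. s n g) \<longlonglongrightarrow> l"
      by (auto simp: convergent_def)
    then obtain l where l: "\<And>g. g \<in> F \<Longrightarrow> (\<lambda>n. s n g) \<longlonglongrightarrow> l g"
      by metis
    define t where "t g = (if g \<in> F then l g else 0)" for g
    have t: "t \<in> supported F"
      by (simp add: supported_def t_def)
    have "(\<lambda>n. sqrt (\<Sum>g\<in>F. (s n g - t g)\<^sup>2)) \<longlonglongrightarrow> sqrt (\<Sum>g\<in>F. (t g - t g)\<^sup>2)"
      by (intro tendsto_intros) (simp add: t_def l)
    then have "(\<lambda>n. hdist H (\<sigma> n) (j t)) \<longlonglongrightarrow> 0"
      by (simp add: s hdist_j t L2_set_def)
    then show "\<exists>x\<in>carrier H. (\<lambda>n. hdist H (\<sigma> n) x) \<longlonglongrightarrow> 0"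
      using t by (intro bexI[of _ "j t"]) auto
  qed (auto simp: algebra_simps sum.distrib sum_distrib_left intro!: sum_nonneg elim!: carrierE)
qed

end

section \<open>Left translation on a finite subgroup and its invariant vectors\<close>

locale finite_regular = finite_l2 F j + group G + F: subgroup F G
  for F :: "'g set" and j :: "('g \<Rightarrow> real) \<Rightarrow> 'h" and G (structure)
begin

abbreviation GF where "GF \<equiv> G\<lparr>carrier := F\<rparr>"

definition translate :: "'g \<Rightarrow> ('g \<Rightarrow> real) \<Rightarrow> 'g \<Rightarrow> real" where
  "translate h v g = (if g \<in> F then v (inv h \<otimes> g) else 0)"

text \<open>\<open>restrict\<close> makes the maps extensional, as membership in \<open>Bij\<close>
  demands.\<close>

definition regular_rep :: "'g \<Rightarrow> 'h \<Rightarrow> 'h" where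
  "regular_rep h = restrict (\<lambda>x. j (translate h (inv_into (supported F) j x))) (carrier H)"

lemma translate_supported [simp]: "translate h v \<in> supported F"
  by (simp add: supported_def translate_def)

lemma regular_rep_j [simp]: "v \<in> supported F \<Longrightarrow> regular_rep h (j v) = j (translate h v)"
  using inj_j by (simp add: regular_rep_def)

lemma translate_translate: "h \<in> F \<Longrightarrow> k \<in> F \<Longrightarrow> translate h (translate k v) = translate (h \<otimes> k) v"
  by (auto simp: translate_def fun_eq_iff inv_mult_group m_assoc)

lemma translate_one: "v \<in> supported F \<Longrightarrow> translate \<one> v = v"
  by (auto simp: translate_def supported_def fun_eq_iff)

lemma sum_translate:
  assumes "h \<in> F"
  shows "(\<Sum>g\<in>F. f (translate h v g)) = (\<Sum>g\<in>F. f (v g))"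
  by (rule sum.reindex_bij_witness[of _ "\<lambda>g. h \<otimes> g" "\<lambda>g. inv h \<otimes> g"])
    (use assms in \<open>auto simp: translate_def simp flip: m_assoc\<close>)

lemma regular_rep_Bij:
  assumes "h \<in> F"
  shows "regular_rep h \<in> Bij (carrier H)"
proof -
  have "bij_betw (regular_rep h) (carrier H) (carrier H)"
    by (rule bij_betw_byWitness[of _ "regular_rep (inv h)"])
      (use assms in \<open>auto simp: translate_translate translate_one elim!: carrierE\<close>)
  then show ?thesis
    by (simp add: Bij_def regular_rep_def)
qed

lemma orthogonal_rep_regular: "orthogonal_rep GF H regular_rep"
proof -
  have "group GF"
    by (rule F.subgroup_is_group) (rule is_group)
  moreover have "regular_rep (h \<otimes> k) = regular_rep h \<otimes>\<^bsub>BijGroup (carrier H)\<^esub> regular_rep k"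
    if "h \<in> F" "k \<in> F" for h k
  proof
    fix x
    show "regular_rep (h \<otimes> k) x = (regular_rep h \<otimes>\<^bsub>BijGroup (carrier H)\<^esub> regular_rep k) x"
    proof (cases "x \<in> carrier H")
      case True
      then show ?thesis
        using that by (auto simp: BijGroup_def regular_rep_Bij compose_def translate_translate
          elim!: carrierE)
    next
      case False
      then have "regular_rep m x = undefined" for m
        by (simp add: regular_rep_def)
      then show ?thesis
        using that False by (simp add: BijGroup_def regular_rep_Bij compose_def)
    qed
  qed
  ultimately have "group_action GF (carrier H) regular_rep"
    by (intro group_action.intro group_hom.intro group_hom_axioms.intro group_BijGroup)
      (auto simp: hom_def regular_rep_Bij BijGroup_def)
  moreover have "translate h (\<lambda>g. u g + v g) = (\<lambda>g. translate h u g + translate h v g)"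
    and "translate h (\<lambda>g. a * u g) = (\<lambda>g. a * translate h u g)" for h u v a
    by (auto simp: translate_def)
  ultimately show ?thesis
    by (auto simp: orthogonal_rep_def hilbert_space_H hnorm_j L2_set_def
      sum_translate[where f="\<lambda>t. t\<^sup>2"] elim!: carrierE)
qed

lemma fixed_vectors_regular:
  "fixed_vectors H regular_rep K = j ` {v \<in> supported F. \<forall>k\<in>K. translate k v = v}"
  by (auto simp: fixed_vectors_def elim!: carrierE)

text \<open>\<open>F\<close> acts transitively on itself, so only constants are invariant.\<close>

lemma fixed_vectors_regular_all:
  assumes "v \<in> supported F" "\<forall>k\<in>F. translate k v = v" "g \<in> F"
  shows "v g = v \<one>"
proof -
  have "translate g v = v"
    using assms by blast
  then have "v g = translate g v g"
    by (rule fun_cong[OF sym])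
  also have "\<dots> = v \<one>"
    using assms(3) by (simp add: translate_def)
  finally show ?thesis .
qed

text \<open>A function of mean zero is orthogonal to the constants, so no invariant vector is nearer
  to it than 0.\<close>

lemma hsetdist_fixed_ge:
  assumes v: "v \<in> supported F" and sum: "(\<Sum>g\<in>F. v g) = 0"
  shows "(\<Sum>g\<in>F. (v g)\<^sup>2) \<le> (hsetdist H (j v) (fixed_vectors H regular_rep F))\<^sup>2"
proof -
  have "L2_set v F \<le> hsetdist H (j v) (fixed_vectors H regular_rep F)"
    unfolding hsetdist_def
  proof (rule cINF_greatest)
    have "translate k (\<lambda>_. 0) = (\<lambda>_. 0)" for k
      by (auto simp: translate_def)
    then show "fixed_vectors H regular_rep F \<noteq> {}"
      unfolding fixed_vectors_regular using supported_simps(1) by fastforce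
  next
    fix w assume "w \<in> fixed_vectors H regular_rep F"
    then obtain u where u: "u \<in> supported F" "\<forall>k\<in>F. translate k u = u" "w = j u"
      by (auto simp: fixed_vectors_regular)
    have "(\<Sum>g\<in>F. (v g - u g)\<^sup>2) = (\<Sum>g\<in>F. (v g - u \<one>)\<^sup>2)"
      by (rule sum.cong[OF refl], subst fixed_vectors_regular_all[OF u(1,2)]) auto
    also have "\<dots> = (\<Sum>g\<in>F. (v g)\<^sup>2 + (u \<one>)\<^sup>2 - (2 * u \<one>) * v g)"
      by (simp add: power2_diff mult_ac)
    also have "\<dots> = (\<Sum>g\<in>F. (v g)\<^sup>2) + card F * (u \<one>)\<^sup>2 - (2 * u \<one>) * (\<Sum>g\<in>F. v g)"
      by (simp only: sum.distrib sum_subtractf sum_constant flip: sum_distrib_left)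
    also have "\<dots> \<ge> (\<Sum>g\<in>F. (v g)\<^sup>2)"
      by (simp add: sum)
    finally show "L2_set v F \<le> hdist H (j v) w"
      using u v by (simp add: hdist_j L2_set_def)
  qed
  then have "(L2_set v F)\<^sup>2 \<le> (hsetdist H (j v) (fixed_vectors H regular_rep F))\<^sup>2"
    by (rule power_mono) simp
  then show ?thesis
    by (simp add: L2_set_def sum_nonneg)
qed

text \<open>The average over \<open>K\<close> is an invariant competitor in the infimum, and its
  squared distance from \<open>v\<close> is the defect.\<close>

lemma hsetdist_fixed_le:
  assumes v: "v \<in> supported F" and K: "subgroup K G" "K \<subseteq> F"
  shows "(hsetdist H (j v) (fixed_vectors H regular_rep K))\<^sup>2 \<le> defect G F K v"
proof -
  define u where "u g = (if g \<in> F then translate_avg G K v g else 0)" for g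
  have u: "u \<in> supported F"
    by (simp add: supported_def u_def)
  have "translate h u = u" if "h \<in> K" for h
  proof
    fix g
    show "translate h u g = u g"
    proof (cases "g \<in> F")
      case True
      have hF: "h \<in> F" "h \<in> carrier G" "g \<in> carrier G"
        using that K True by auto
      \<comment> \<open>Left multiplication by \<open>h\<close> permutes \<open>K\<close>, and
        inverting \<open>h \<otimes> k\<close> produces the factor \<open>inv h\<close>.\<close>
      have "(\<Sum>k\<in>K. v (inv k \<otimes> (inv h \<otimes> g))) = (\<Sum>k\<in>K. v (inv k \<otimes> g))"
      proof (rule sum.reindex_bij_witness[of _ "\<lambda>k. inv h \<otimes> k" "\<lambda>k. h \<otimes> k"])
        fix k assume "k \<in> K"
        then have k: "k \<in> K" "k \<in> carrier G"
          using subgroup.mem_carrier[OF K(1)] by auto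
        show "inv h \<otimes> (h \<otimes> k) = k" "h \<otimes> (inv h \<otimes> k) = k"
          using k hF by (simp_all flip: m_assoc)
        show "h \<otimes> k \<in> K" "inv h \<otimes> k \<in> K"
          using k that K(1) by (simp_all add: subgroup.m_closed subgroup.m_inv_closed)
        show "v (inv (h \<otimes> k) \<otimes> g) = v (inv k \<otimes> (inv h \<otimes> g))"
          using k hF by (simp add: inv_mult_group m_assoc)
      qed
      then show ?thesis
        using hF True by (simp add: translate_def u_def translate_avg_def)
    qed (simp add: translate_def u_def)
  qed
  then have mem: "j u \<in> fixed_vectors H regular_rep K"
    using u by (auto simp: fixed_vectors_regular)
  have nonneg: "0 \<le> hdist H (j v) w" if "w \<in> fixed_vectors H regular_rep K" for w
    using that v by (auto simp: fixed_vectors_regular hdist_j)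
  have "hsetdist H (j v) (fixed_vectors H regular_rep K) \<le> hdist H (j v) (j u)"
    unfolding hsetdist_def by (rule cINF_lower[OF bdd_belowI2[OF nonneg] mem])
  moreover have "0 \<le> hsetdist H (j v) (fixed_vectors H regular_rep K)"
    unfolding hsetdist_def using nonneg mem by (intro cINF_greatest) auto
  ultimately have "(hsetdist H (j v) (fixed_vectors H regular_rep K))\<^sup>2 \<le> (hdist H (j v) (j u))\<^sup>2"
    by (rule power_mono)
  also have "\<dots> = defect G F K v"
    using u v by (simp add: hdist_j L2_set_def sum_nonneg defect_def u_def)
  finally show ?thesis .
qed

text \<open>A nonzero function of mean zero is not constant, hence not \<open>F\<close>-invariant,
  so the pair condition applies to it in the regular representation. The estimates of the distances
  from below and above turn that into an inequality between explicit quadratic forms.\<close>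

lemma sum_squares_less_defects:
  assumes pair: "pair_condition G K L TYPE('h)"
    and F_eq: "F = generate G (K \<union> L)"
    and K: "subgroup K G" and L: "subgroup L G"
    and v: "v \<in> supported F" "(\<Sum>g\<in>F. v g) = 0" "v \<noteq> (\<lambda>_. 0)"
  shows "(\<Sum>g\<in>F. (v g)\<^sup>2) < 2 * (defect G F K v + defect G F L v)"
proof -
  have KF: "K \<subseteq> F" and LF: "L \<subseteq> F"
    unfolding F_eq by (blast intro: generate.incl)+
  have "j v \<notin> fixed_vectors H regular_rep F"
  proof
    assume "j v \<in> fixed_vectors H regular_rep F"
    then have const: "v g = v \<one>" if "g \<in> F" for g
      using fixed_vectors_regular_all[OF v(1) _ that] v(1) by (auto simp: fixed_vectors_def)
    have "(\<Sum>g\<in>F. v g) = (\<Sum>g\<in>F. v \<one>)"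
      by (intro sum.cong refl const)
    with v(2) have "(\<Sum>g\<in>F. v \<one>) = 0"
      by (rule trans[OF sym, rotated])
    then have "card F * v \<one> = 0"
      by simp
    moreover have "F \<noteq> {}"
      using F.one_closed by blast
    ultimately have "v \<one> = 0"
      using finite_F by simp
    have "v g = 0" if "g \<in> F" for g
      using const[OF that] \<open>v \<one> = 0\<close> by (rule trans)
    then have "v = (\<lambda>_. 0)"
      using v(1) by (intro supported_eqI[of _ F]) simp_all
    with v(3) show False ..
  qed
  then have "(hsetdist H (j v) (fixed_vectors H regular_rep F))\<^sup>2
             < 2 * ((hsetdist H (j v) (fixed_vectors H regular_rep K))\<^sup>2
                  + (hsetdist H (j v) (fixed_vectors H regular_rep L))\<^sup>2)"
    by (rule pair[unfolded pair_condition_def, folded F_eq, rule_format,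
        OF orthogonal_rep_regular j_carrier[OF v(1)]])
  also have "\<dots> \<le> 2 * (defect G F K v + defect G F L v)"
    using hsetdist_fixed_le[OF v(1) K KF] hsetdist_fixed_le[OF v(1) L LF] by simp
  finally show ?thesis
    using hsetdist_fixed_ge[OF v(1,2)] by (rule order_le_less_trans[rotated])
qed

end

section \<open>Compactness and the uniform constant\<close>

text \<open>The target may be a line while \<open>F\<close> is large, so the injection rests on
  cardinality instead of linearity. Each coordinate becomes a set of naturals, pairing with the
  index of \<open>g\<close> merges these sets into one, and the result is read as a real multiple of
  \<open>a\<close>.\<close>

lemma ex_inj_on_supported:
  fixes a :: "'h::real_vector"
  assumes "finite F" "a \<noteq> 0"
  obtains j :: "('g \<Rightarrow> real) \<Rightarrow> 'h" where "inj_on j (supported F)"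
proof -
  obtain b :: "nat set \<Rightarrow> real" and c :: "real \<Rightarrow> nat set" where b: "inj b" and c: "inj c"
    using nat_sets_eqpoll_reals by (metis eqpoll_def eqpoll_sym bij_is_inj)
  obtain i :: "'g \<Rightarrow> nat" where i: "inj_on i F"
    using finite_imp_inj_to_nat_seg[OF assms(1)] by blast
  define code where "code v = {prod_encode (i g, m) | g m. g \<in> F \<and> m \<in> c (v g)}"
    for v :: "'g \<Rightarrow> real"
  have "v g = (w g :: real)" if "code v = code w" "g \<in> F" for v w g
  proof -
    have "m \<in> c (u g) \<longleftrightarrow> prod_encode (i g, m) \<in> code u" for m u
      using that(2) i by (auto simp: code_def dest: inj_onD)
    then have "c (v g) = c (w g)"
      using that(1) by blast
    then show ?thesis
      using c by (simp add: inj_eq)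
  qed
  then have "inj_on code (supported F)"
    by (auto intro!: inj_onI supported_eqI[of _ F])
  then have "inj_on (\<lambda>v. b (code v) *\<^sub>R a) (supported F)"
    using assms(2) b by (auto simp: inj_on_def)
  then show thesis
    by (rule that)
qed

text \<open>The function type carries the product topology. By Tychonoff, an interval at each point
  of \<open>F\<close> and a single point elsewhere give a compact box; the two equations involve
  finitely many coordinates and are therefore closed.\<close>

lemma compact_mean_zero_sphere:
  assumes "finite F"
  shows "compact {v \<in> supported F. (\<Sum>g\<in>F. v g) = 0 \<and> (\<Sum>g\<in>F. (v g)\<^sup>2) = 1}" (is "compact ?S")
proof -
  define B where "B g = (if g \<in> F then {-1..1} else {0 :: real})" for g
  have "compactin (product_topology (\<lambda>_. euclidean) UNIV) (PiE UNIV B)"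
    by (auto simp: compactin_PiE B_def)
  then have "compact (PiE UNIV B)"
    by (simp add: euclidean_product_topology)
  moreover have "closed {v :: 'a \<Rightarrow> real. (\<Sum>g\<in>F. v g) = 0}" "closed {v :: 'a \<Rightarrow> real. (\<Sum>g\<in>F. (v g)\<^sup>2) = 1}"
    by (intro closed_Collect_eq continuous_intros continuous_on_product_coordinates)+
  ultimately have "compact (PiE UNIV B \<inter> {v. (\<Sum>g\<in>F. v g) = 0} \<inter> {v. (\<Sum>g\<in>F. (v g)\<^sup>2) = 1})"
    by (intro compact_Int_closed)
  also have "PiE UNIV B \<inter> {v. (\<Sum>g\<in>F. v g) = 0} \<inter> {v. (\<Sum>g\<in>F. (v g)\<^sup>2) = 1} = ?S"
  proof -
    have "v g \<in> B g" if "v \<in> supported F" "(\<Sum>g\<in>F. (v g)\<^sup>2) = 1" for v g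
    proof (cases "g \<in> F")
      case True
      then have "(v g)\<^sup>2 \<le> 1"
        using member_le_sum[OF True, of "\<lambda>g. (v g)\<^sup>2"] assms that by simp
      then show ?thesis
        using True by (simp add: B_def abs_square_le_1 abs_le_iff)
    qed (use that in \<open>simp add: B_def supported_def\<close>)
    moreover have "v \<in> supported F" if "v \<in> PiE UNIV B" for v
    proof -
      have "v g = 0" if "g \<notin> F" for g
        using PiE_mem[OF \<open>v \<in> PiE UNIV B\<close>, of g] that by (simp add: B_def)
      then show ?thesis
        by (simp add: supported_def)
    qed
    ultimately show ?thesis
      by (auto simp: PiE_UNIV_domain Pi_iff)
  qed
  finally show ?thesis .
qed

lemma defect_nonneg: "0 \<le> defect G F K v"
  by (simp add: defect_def sum_nonneg)

lemma defect_scale: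
  fixes v :: "'g \<Rightarrow> real"
  shows "defect G F K (\<lambda>g. a * v g) = a\<^sup>2 * defect G F K v"
proof -
  have "a * v g - translate_avg G K (\<lambda>g. a * v g) g = a * (v g - translate_avg G K v g)" for g
    by (simp add: translate_avg_def algebra_simps flip: sum_distrib_left)
  then show ?thesis
    by (simp add: defect_def power_mult_distrib sum_distrib_left)
qed

text \<open>On the compact sphere the continuous \<open>q\<close> attains its minimum, which exceeds
  1/2 by strictness. Both sides are homogeneous of degree two, so the bound \<open>1 / m\<close>
  spreads to all functions of mean zero; the maximum with 1 secures
  \<open>1 \<le> \<rho>\<close>.\<close>

lemma uniform_defect_bound:
  assumes "finite F"
    and strict: "\<And>v. v \<in> supported F \<Longrightarrow> (\<Sum>g\<in>F. v g) = 0 \<Longrightarrow> v \<noteq> (\<lambda>_. 0) \<Longrightarrow>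
      (\<Sum>g\<in>F. (v g)\<^sup>2) < 2 * (defect G F K v + defect G F L v)"
  obtains \<rho> where "1 \<le> \<rho>" "\<rho> < 2"
    "\<And>v. v \<in> supported F \<Longrightarrow> (\<Sum>g\<in>F. v g) = 0 \<Longrightarrow>
      (\<Sum>g\<in>F. (v g)\<^sup>2) \<le> \<rho> * (defect G F K v + defect G F L v)"
proof -
  define q where "q v = defect G F K v + defect G F L v" for v :: "'a \<Rightarrow> real"
  define S where "S = {v \<in> supported F. (\<Sum>g\<in>F. v g) = 0 \<and> (\<Sum>g\<in>F. (v g)\<^sup>2) = 1}"
  have "\<exists>m>1/2. \<forall>u\<in>S. m \<le> q u"
  proof (cases "S = {}")
    \<comment> \<open>The sphere is empty when \<open>F\<close> has at most one element; then every
      \<open>m\<close> above 1/2 serves.\<close>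
    case True
    then show ?thesis
      by (auto intro: exI[of _ 1])
  next
    case False
    have "continuous_on S q"
      unfolding q_def defect_def translate_avg_def
      by (rule continuous_on_subset[of UNIV])
        (intro continuous_intros continuous_on_product_coordinates, simp)
    then obtain u where u: "u \<in> S" "\<And>v. v \<in> S \<Longrightarrow> q u \<le> q v"
      using continuous_attains_inf[of S q] compact_mean_zero_sphere[OF assms(1)] False
      unfolding S_def by blast
    moreover have "u \<noteq> (\<lambda>_. 0)"
      using u(1) by (auto simp: S_def)
    then have "1 / 2 < q u"
      using strict[of u] u(1) by (simp add: S_def q_def)
    ultimately show ?thesis
      by blast
  qed
  then obtain m where m: "m > 1/2" "\<And>u. u \<in> S \<Longrightarrow> m \<le> q u"
    by blast
  have bound: "(\<Sum>g\<in>F. (v g)\<^sup>2) \<le> max 1 (1 / m) * q v"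
    if v: "v \<in> supported F" "(\<Sum>g\<in>F. v g) = 0" for v
  proof (cases "(\<Sum>g\<in>F. (v g)\<^sup>2) = 0")
    case False
    define N where "N = L2_set v F"
    have N: "N\<^sup>2 = (\<Sum>g\<in>F. (v g)\<^sup>2)"
      by (simp add: N_def L2_set_def sum_nonneg)
    have "N \<noteq> 0"
      using False N by auto
    define u where "u g = (1 / N) * v g" for g
    have "(\<Sum>g\<in>F. (u g)\<^sup>2) = (1 / N)\<^sup>2 * N\<^sup>2"
      unfolding u_def N power_mult_distrib by (simp add: sum_distrib_left)
    then have "(\<Sum>g\<in>F. (u g)\<^sup>2) = 1"
      using \<open>N \<noteq> 0\<close> by (simp add: power_divide)
    moreover have "(\<Sum>g\<in>F. u g) = 0"
      using v(2) unfolding u_def by (simp flip: sum_divide_distrib)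
    moreover have "u \<in> supported F"
      using v(1) unfolding u_def by (rule supported_simps)
    ultimately have "u \<in> S"
      by (simp add: S_def)
    then have "m \<le> (1 / N)\<^sup>2 * q v"
      using m(2)[of u] by (simp add: q_def u_def[abs_def] defect_scale[of G F _ "1 / N"] distrib_left
          del: times_divide_eq_left)
    then have "m * N\<^sup>2 \<le> q v"
      using \<open>N \<noteq> 0\<close> by (simp add: power_divide field_simps)
    then have "N\<^sup>2 \<le> 1 / m * q v"
      using m(1) by (simp add: field_simps)
    also have "\<dots> \<le> max 1 (1 / m) * q v"
      by (intro mult_right_mono) (simp_all add: q_def defect_nonneg)
    finally show ?thesis
      by (simp add: N)
  qed (auto simp: q_def defect_nonneg)
  have "max 1 (1 / m) < 2"
    using m(1) by (simp add: field_simps)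
  then show thesis
    using that[of "max 1 (1 / m)"] bound by (simp add: q_def)
qed

section \<open>Isometric actions\<close>

lemma affine_isometry_dist: "affine_isometry f \<Longrightarrow> dist (f x) (f y) = dist x y"
  unfolding affine_isometry_def dist_norm
  by (metis add_diff_cancel_right linear_diff)

text \<open>Affine maps preserve barycentres: the weights add up to 1, so the translation part
  \<open>b\<close> comes out once.\<close>

lemma affine_isometry_mean:
  assumes "affine_isometry f" "finite K" "K \<noteq> {}"
  shows "f ((\<Sum>k\<in>K. y k) /\<^sub>R real (card K)) = (\<Sum>k\<in>K. f (y k)) /\<^sub>R real (card K)"
proof -
  obtain A b where A: "linear A" and f: "\<And>x. f x = A x + b"
    using assms(1) unfolding affine_isometry_def by blast
  have "(\<Sum>k\<in>K. f (y k)) = A (\<Sum>k\<in>K. y k) + real (card K) *\<^sub>R b"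
    using A by (simp add: f sum.distrib linear_sum sum_constant_scaleR)
  then show ?thesis
    using assms by (simp add: f linear_cmul[OF A] scaleR_add_right)
qed

locale isometric_action = group_action G UNIV \<alpha>
  for G (structure) and \<alpha> :: "'g \<Rightarrow> 'h::real_inner \<Rightarrow> 'h" +
  assumes affine: "g \<in> carrier G \<Longrightarrow> affine_isometry (\<alpha> g)"
begin

sublocale group G
  using group_hom group_hom.axioms(1) by blast

definition mean :: "'g set \<Rightarrow> 'h \<Rightarrow> 'h" where
  "mean K x = (\<Sum>k\<in>K. \<alpha> k x) /\<^sub>R real (card K)"

definition fixed :: "'g set \<Rightarrow> 'h set" where
  "fixed K = {x. \<forall>k\<in>K. \<alpha> k x = x}"

lemma act_mult: "g \<in> carrier G \<Longrightarrow> h \<in> carrier G \<Longrightarrow> \<alpha> (g \<otimes> h) x = \<alpha> g (\<alpha> h x)"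
  by (rule composition_rule) auto

lemma act_one: "\<alpha> \<one> x = x"
  by (metis UNIV_I id_eq_one restrict_apply')

lemma dist_act: "g \<in> carrier G \<Longrightarrow> dist (\<alpha> g x) (\<alpha> g y) = dist x y"
  by (rule affine_isometry_dist[OF affine])

lemma subgroup_nonempty: "subgroup K G \<Longrightarrow> K \<noteq> {}"
  using subgroup.one_closed by fastforce

text \<open>An affine map commutes with the mean, and left multiplication by \<open>h\<close>
  permutes \<open>K\<close>.\<close>

lemma mean_in_fixed:
  assumes K: "subgroup K G" "finite K"
  shows "mean K x \<in> fixed K"
proof -
  have "\<alpha> h (mean K x) = mean K x" if h: "h \<in> K" for h
  proof -
    have hG: "h \<in> carrier G"
      using K h by (auto dest: subgroup.subset)
    have "\<alpha> h (mean K x) = (\<Sum>k\<in>K. \<alpha> h (\<alpha> k x)) /\<^sub>R real (card K)"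
      unfolding mean_def
      by (rule affine_isometry_mean[OF affine[OF hG] K(2) subgroup_nonempty[OF K(1)]])
    also have "(\<Sum>k\<in>K. \<alpha> h (\<alpha> k x)) = (\<Sum>k\<in>K. \<alpha> (h \<otimes> k) x)"
      using hG by (intro sum.cong) (auto simp: act_mult subgroup.mem_carrier[OF K(1)])
    also have "\<dots> = (\<Sum>k\<in>K. \<alpha> k x)"
      by (rule sum.reindex_bij_witness[of _ "\<lambda>k. inv h \<otimes> k" "\<lambda>k. h \<otimes> k"])
        (use K h hG in \<open>auto simp: subgroup.m_closed subgroup.m_inv_closed subgroup.mem_carrier
          simp flip: m_assoc\<close>)
    finally show ?thesis
      by (simp add: mean_def)
  qed
  then show ?thesis
    by (simp add: fixed_def)
qed

text \<open>By polarisation the inner product depends only on distances to and between the fixed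
  points \<open>p\<close> and \<open>q\<close>, so it is the same for every point of the orbit of
  \<open>x\<close>. Summed over the orbit it vanishes, since deviations from the mean
  cancel.\<close>

lemma mean_orthogonal:
  assumes K: "subgroup K G" "finite K" and p: "p \<in> fixed K"
  shows "(x - mean K x) \<bullet> (mean K x - p) = 0"
proof -
  define q where "q = mean K x"
  have q: "q \<in> fixed K"
    unfolding q_def using K by (rule mean_in_fixed)
  have "(\<alpha> k x - q) \<bullet> (q - p) = (x - q) \<bullet> (q - p)" if "k \<in> K" for k
  proof -
    have polar: "(y - q) \<bullet> (q - p) = ((dist y p)\<^sup>2 - (dist y q)\<^sup>2 - (dist q p)\<^sup>2) / 2" for y
      by (simp add: dist_norm power2_norm_eq_inner inner_diff_left inner_diff_right inner_commute)
    have "\<alpha> k p = p" "\<alpha> k q = q" "k \<in> carrier G"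
      using p q K that by (auto simp: fixed_def dest: subgroup.subset)
    then have "dist (\<alpha> k x) p = dist x p" "dist (\<alpha> k x) q = dist x q"
      using dist_act[of k x p] dist_act[of k x q] by simp_all
    then show ?thesis
      unfolding polar by simp
  qed
  then have "(\<Sum>k\<in>K. (\<alpha> k x - q) \<bullet> (q - p)) = real (card K) * ((x - q) \<bullet> (q - p))"
    by simp
  moreover have "(\<Sum>k\<in>K. \<alpha> k x - q) = 0"
    using K by (simp add: q_def mean_def sum_subtractf sum_constant_scaleR subgroup_nonempty)
  then have "(\<Sum>k\<in>K. (\<alpha> k x - q) \<bullet> (q - p)) = 0"
    by (simp flip: inner_sum_left)
  ultimately show ?thesis
    using K subgroup_nonempty by (simp add: q_def)
qed

lemma norm_diff_mean_le:
  assumes "subgroup K G" "finite K" "p \<in> fixed K"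
  shows "norm (x - mean K x) \<le> norm (x - p)"
proof -
  have "(norm (x - p))\<^sup>2 = (norm ((x - mean K x) + (mean K x - p)))\<^sup>2"
    by simp
  also have "\<dots> = (norm (x - mean K x))\<^sup>2 + (norm (mean K x - p))\<^sup>2"
    by (rule norm_add_Pythagorean) (simp add: orthogonal_def mean_orthogonal[OF assms])
  finally show ?thesis
    by (metis le_add_same_cancel1 norm_ge_zero power2_le_imp_le zero_le_power2)
qed

text \<open>The left side is \<open>translate_avg\<close> of the orbit map
  \<open>\<lambda>g. \<alpha> (inv g) x\<close>.\<close>

lemma mean_act_orbit:
  assumes "finite K" "K \<noteq> {}" "K \<subseteq> carrier G" "g \<in> carrier G"
  shows "(\<Sum>k\<in>K. \<alpha> (inv (inv k \<otimes> g)) x) /\<^sub>R real (card K) = \<alpha> (inv g) (mean K x)"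
proof -
  have "\<alpha> (inv (inv k \<otimes> g)) x = \<alpha> (inv g) (\<alpha> k x)" if "k \<in> K" for k
  proof -
    have "k \<in> carrier G" using that assms by auto
    then show ?thesis using assms(4) by (simp add: inv_mult_group act_mult)
  qed
  then have "(\<Sum>k\<in>K. \<alpha> (inv (inv k \<otimes> g)) x) = (\<Sum>k\<in>K. \<alpha> (inv g) (\<alpha> k x))"
    by simp
  then show ?thesis
    using assms by (simp add: mean_def affine_isometry_mean[OF affine])
qed

text \<open>The inequality is applied to the orbit map \<open>W\<close>, centred at the mean over
  \<open>F\<close>. As \<open>\<alpha> (inv g)\<close> is an isometry fixing that centre, all
  summands for different \<open>g\<close> agree, and both sides are \<open>card F\<close> times
  those of the claim.\<close>

lemma norm_diff_mean_le_pair: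
  assumes F: "subgroup F G" "finite F"
    and K: "subgroup K G" "K \<subseteq> F" and L: "subgroup L G" "L \<subseteq> F"
    and scalar: "\<And>v :: 'g \<Rightarrow> real. (\<And>g. g \<notin> F \<Longrightarrow> v g = 0) \<Longrightarrow> (\<Sum>g\<in>F. v g) = 0 \<Longrightarrow>
      (\<Sum>g\<in>F. (v g)\<^sup>2) \<le> \<rho> * (defect G F K v + defect G F L v)"
  shows "(norm (x - mean F x))\<^sup>2 \<le>
    \<rho> * ((norm (x - mean K x))\<^sup>2 + (norm (x - mean L x))\<^sup>2)"
proof -
  define W where "W g = \<alpha> (inv g) x - mean F x" for g
  have FG: "F \<subseteq> carrier G"
    using F(1) by (rule subgroup.subset)
  have card: "card F > 0"
    using F subgroup_nonempty by (auto simp: card_gt_0_iff)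
  have "(\<Sum>g\<in>F. \<alpha> (inv g) x) = (\<Sum>g\<in>F. \<alpha> g x)"
    by (rule sum.reindex_bij_witness[of _ "\<lambda>k. inv k" "\<lambda>k. inv k"])
      (use F FG in \<open>auto simp: subgroup.m_inv_closed\<close>)
  then have sum0: "(\<Sum>g\<in>F. W g) = 0"
    using card by (simp add: W_def mean_def sum_subtractf sum_constant_scaleR)
  have normW: "norm (W g) = norm (x - mean F x)" if "g \<in> F" for g
  proof -
    have "\<alpha> (inv g) (mean F x) = mean F x"
      using mean_in_fixed[OF F] that F(1) by (auto simp: fixed_def subgroup.m_inv_closed)
    then show ?thesis
      using dist_act[of "inv g" x "mean F x"] that FG by (auto simp: W_def dist_norm)
  qed
  have defW: "defect G F M W = card F * (norm (x - mean M x))\<^sup>2" if M: "subgroup M G" "M \<subseteq> F" for M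
  proof -
    have fin: "finite M" "M \<noteq> {}" "M \<subseteq> carrier G"
      using M F FG subgroup_nonempty finite_subset by auto
    have "norm (W g - translate_avg G M W g) = norm (x - mean M x)" if "g \<in> F" for g
    proof -
      have g: "g \<in> carrier G" using that FG by auto
      have "translate_avg G M W g = \<alpha> (inv g) (mean M x) - mean F x"
        using mean_act_orbit[OF fin g, of x] fin
        by (simp add: translate_avg_def W_def sum_subtractf sum_constant_scaleR scaleR_diff_right)
      then show ?thesis
        using dist_act[of "inv g" x "mean M x"] g by (simp add: W_def dist_norm)
    qed
    then show ?thesis
      by (simp add: defect_def)
  qed
  have "(\<Sum>g\<in>F. (norm (W g))\<^sup>2) \<le> \<rho> * (defect G F K W + defect G F L W)"
    by (rule defect_inequality_vector_valued[OF is_group F(1) K(2) L(2) F(2) scalar sum0])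
  then have "card F * (norm (x - mean F x))\<^sup>2 \<le>
      card F * (\<rho> * ((norm (x - mean K x))\<^sup>2 + (norm (x - mean L x))\<^sup>2))"
    by (simp add: normW defW[OF K] defW[OF L] algebra_simps)
  then show ?thesis
    using card by simp
qed

text \<open>
  With \<open>u, w\<close> the displacements and \<open>y = x - mean F x\<close>, orthogonality gives
  \<open>(u + w) \<bullet> y = \<bar>u\<bar>\<^sup>2 + \<bar>w\<bar>\<^sup>2\<close>; Cauchy-Schwarz and the bound on \<open>\<bar>y\<bar>\<^sup>2\<close> do the rest.
\<close>
lemma norm_add_displacements_ge:
  assumes F: "subgroup F G" "finite F"
    and K: "subgroup K G" "K \<subseteq> F" and L: "subgroup L G" "L \<subseteq> F" and "\<rho> > 0"
    and bound: "(norm (x - mean F x))\<^sup>2 \<le>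
      \<rho> * ((norm (x - mean K x))\<^sup>2 + (norm (x - mean L x))\<^sup>2)"
  shows "((norm (x - mean K x))\<^sup>2 + (norm (x - mean L x))\<^sup>2) / \<rho> \<le>
    (norm ((x - mean K x) + (x - mean L x)))\<^sup>2"
proof -
  define u w y where "u = x - mean K x" and "w = x - mean L x" and "y = x - mean F x"
  define s where "s = (norm u)\<^sup>2 + (norm w)\<^sup>2"
  have inner: "(x - mean M x) \<bullet> y = (norm (x - mean M x))\<^sup>2" if M: "subgroup M G" "M \<subseteq> F" for M
  proof -
    \<comment> \<open>A point fixed by \<open>F\<close> is fixed by \<open>M\<close>, so the mean
      over \<open>F\<close> can serve as \<open>p\<close> in \<open>mean_orthogonal\<close>.\<close>
    have "mean F x \<in> fixed M"
      using mean_in_fixed[OF F] M by (auto simp: fixed_def)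
    then have "(x - mean M x) \<bullet> (mean M x - mean F x) = 0"
      using mean_orthogonal M F finite_subset by blast
    moreover have "(x - mean M x) \<bullet> y =
        (x - mean M x) \<bullet> (x - mean M x) + (x - mean M x) \<bullet> (mean M x - mean F x)"
      by (simp add: y_def flip: inner_add_right)
    ultimately show ?thesis
      by (simp add: power2_norm_eq_inner)
  qed
  have "s = (u + w) \<bullet> y"
    using inner[OF K] inner[OF L] by (simp add: s_def u_def w_def inner_add_left)
  also have "\<dots> \<le> norm (u + w) * norm y"
    by (rule norm_cauchy_schwarz)
  finally have "s\<^sup>2 \<le> (norm (u + w) * norm y)\<^sup>2"
    by (rule power_mono) (simp add: s_def)
  also have "\<dots> \<le> (norm (u + w))\<^sup>2 * (\<rho> * s)"
    using bound by (auto simp: power_mult_distrib s_def u_def w_def y_def intro: mult_left_mono)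
  finally have *: "s * s \<le> (norm (u + w))\<^sup>2 * \<rho> * s"
    by (simp add: power2_eq_square mult.assoc)
  have "s \<ge> 0"
    by (simp add: s_def)
  have "s \<le> (norm (u + w))\<^sup>2 * \<rho>"
  proof (cases "s = 0")
    case False
    then show ?thesis
      using * \<open>s \<ge> 0\<close> by (intro mult_right_le_imp_le[OF *]) auto
  qed (use \<open>\<rho> > 0\<close> in simp)
  then show ?thesis
    using \<open>\<rho> > 0\<close> by (simp add: s_def u_def w_def divide_le_eq)
qed

end

section \<open>Contraction of the energy\<close>

lemma Cauchy_geometric:
  fixes x :: "nat \<Rightarrow> 'a::metric_space"
  assumes step: "\<And>n. dist (x n) (x (Suc n)) \<le> c * r ^ n" and r: "0 \<le> r" "r < 1"
  shows "Cauchy x"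
proof -
  have "0 \<le> c"
    using step[of 0] order_trans[OF zero_le_dist] by fastforce
  \<comment> \<open>The partial geometric sum, multiplied through by \<open>1 - r\<close> so that
    the induction is free of quotients.\<close>
  have partial: "(1 - r) * dist (x m) (x (m + k)) \<le> c * r ^ m * (1 - r ^ k)" for m k
  proof (induction k)
    case (Suc k)
    have "dist (x m) (x (m + Suc k)) \<le> dist (x m) (x (m + k)) + c * r ^ (m + k)"
      using step[of "m + k"] dist_triangle[of "x m" "x (m + Suc k)" "x (m + k)"] by simp
    then have "(1 - r) * dist (x m) (x (m + Suc k)) \<le>
        (1 - r) * (dist (x m) (x (m + k)) + c * r ^ (m + k))"
      using r by (intro mult_left_mono) auto
    also have "\<dots> \<le> c * r ^ m * (1 - r ^ k) + (1 - r) * (c * r ^ (m + k))"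
      using Suc by (simp add: distrib_left)
    also have "\<dots> = c * r ^ m * (1 - r ^ Suc k)"
      by (simp add: algebra_simps power_add)
    finally show ?case .
  qed simp
  show ?thesis
    unfolding Cauchy_altdef2
  proof (intro allI impI)
    fix e :: real assume "e > 0"
    have "(\<lambda>n. c * r ^ n) \<longlonglongrightarrow> c * 0"
      using r by (intro tendsto_intros LIMSEQ_power_zero) simp
    then have "\<forall>\<^sub>F n in sequentially. c * r ^ n < (1 - r) * e"
      using r \<open>e > 0\<close> by (intro order_tendstoD) auto
    then obtain N where N: "c * r ^ N < (1 - r) * e"
      by (auto simp: eventually_sequentially)
    have "dist (x n) (x N) < e" if "n \<ge> N" for n
    proof -
      have "(1 - r) * dist (x n) (x N) \<le> c * r ^ N * (1 - r ^ (n - N))"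
        using partial[of N "n - N"] that by (simp add: dist_commute)
      also have "\<dots> \<le> c * r ^ N"
        using r \<open>0 \<le> c\<close> by (simp add: mult_left_le)
      also note N
      finally show ?thesis
        using r by simp
    qed
    then show "\<exists>N. \<forall>n\<ge>N. dist (x n) (x N) < e"
      by blast
  qed
qed

text \<open>Since \<open>\<Sum> \<bar>u\<^sub>i + u\<^sub>j\<bar>\<^sup>2 = \<bar>u\<^sub>1 + u\<^sub>2 + u\<^sub>3\<bar>\<^sup>2 + \<Sum> \<bar>u\<^sub>i\<bar>\<^sup>2\<close>, the bound \<open>\<rho> < 2\<close> is what makes
  the right-hand side positive.\<close>
lemma norm_sum3_ge:
  fixes u v w :: "'a::real_inner"
  assumes "((norm u)\<^sup>2 + (norm v)\<^sup>2) / \<rho> \<le> (norm (u + v))\<^sup>2"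
    and "((norm u)\<^sup>2 + (norm w)\<^sup>2) / \<rho> \<le> (norm (u + w))\<^sup>2"
    and "((norm v)\<^sup>2 + (norm w)\<^sup>2) / \<rho> \<le> (norm (v + w))\<^sup>2"
  shows "(2 / \<rho> - 1) * ((norm u)\<^sup>2 + (norm v)\<^sup>2 + (norm w)\<^sup>2) \<le> (norm (u + v + w))\<^sup>2"
proof -
  have "(norm (u + v + w))\<^sup>2 =
    (norm (u + v))\<^sup>2 + (norm (u + w))\<^sup>2 + (norm (v + w))\<^sup>2 - ((norm u)\<^sup>2 + (norm v)\<^sup>2 + (norm w)\<^sup>2)"
    by (simp add: power2_norm_eq_inner inner_add_left inner_add_right inner_commute)
  moreover have "(2 / \<rho> - 1) * ((norm u)\<^sup>2 + (norm v)\<^sup>2 + (norm w)\<^sup>2) =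
    ((norm u)\<^sup>2 + (norm v)\<^sup>2) / \<rho> + ((norm u)\<^sup>2 + (norm w)\<^sup>2) / \<rho> + ((norm v)\<^sup>2 + (norm w)\<^sup>2) / \<rho>
    - ((norm u)\<^sup>2 + (norm v)\<^sup>2 + (norm w)\<^sup>2)"
    by (simp add: add_divide_distrib algebra_simps)
  ultimately show ?thesis
    using assms by linarith
qed

text \<open>The cross terms contribute -2/3 and the squares 3/9 of the squared norm of
  \<open>s\<close>, together -1/3.\<close>

lemma sum3_norm_diff_third:
  fixes u v w :: "'a::real_inner"
  defines "s \<equiv> u + v + w"
  shows "(norm (u - s /\<^sub>R 3))\<^sup>2 + (norm (v - s /\<^sub>R 3))\<^sup>2 + (norm (w - s /\<^sub>R 3))\<^sup>2 =
    (norm u)\<^sup>2 + (norm v)\<^sup>2 + (norm w)\<^sup>2 - (norm s)\<^sup>2 / 3"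
proof -
  have "(norm (y - s /\<^sub>R 3))\<^sup>2 = (norm y)\<^sup>2 - 2 / 3 * (y \<bullet> s) + (norm s)\<^sup>2 / 9" for y
    unfolding power2_norm_eq_inner
    by (simp add: inner_diff_left inner_diff_right inner_commute)
  from this[of u] this[of v] this[of w]
  have "(norm (u - s /\<^sub>R 3))\<^sup>2 + (norm (v - s /\<^sub>R 3))\<^sup>2 + (norm (w - s /\<^sub>R 3))\<^sup>2 =
      (norm u)\<^sup>2 + (norm v)\<^sup>2 + (norm w)\<^sup>2 - 2 / 3 * (u \<bullet> s + v \<bullet> s + w \<bullet> s) + (norm s)\<^sup>2 / 3"
    by (simp only:) (simp add: algebra_simps)
  moreover have "u \<bullet> s + v \<bullet> s + w \<bullet> s = (norm s)\<^sup>2"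
    by (simp add: s_def power2_norm_eq_inner inner_add_left)
  ultimately show ?thesis
    by simp
qed

section \<open>The centroid iteration and its limit\<close>

context isometric_action
begin

definition energy :: "(nat \<Rightarrow> 'g set) \<Rightarrow> 'h \<Rightarrow> real" where
  "energy K x = (norm (x - mean (K 1) x))\<^sup>2 + (norm (x - mean (K 2) x))\<^sup>2 + (norm (x - mean (K 3) x))\<^sup>2"

definition centroid :: "(nat \<Rightarrow> 'g set) \<Rightarrow> 'h \<Rightarrow> 'h" where
  "centroid K x = (mean (K 1) x + mean (K 2) x + mean (K 3) x) /\<^sub>R 3"

lemma energy_nonneg: "0 \<le> energy K x"
  by (simp add: energy_def)

text \<open>The centroid is \<open>x - s /\<^sub>R 3\<close> with \<open>s\<close> the sum of the
  displacements. Measuring it against the old means lowers the energy by a third of the squared norm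
  of \<open>s\<close>, which \<open>norm_sum3_ge\<close> bounds from below.\<close>

lemma
  assumes K: "\<And>i. i \<in> {1, 2, 3} \<Longrightarrow> subgroup (K i) G"
    and fin: "\<And>i. i \<in> {1, 2, 3} \<Longrightarrow> finite (K i)"
    and pairs: "\<And>i j. (i, j) \<in> {(1, 2), (1, 3), (2, 3)} \<Longrightarrow>
      ((norm (x - mean (K i) x))\<^sup>2 + (norm (x - mean (K j) x))\<^sup>2) / \<rho> \<le>
      (norm ((x - mean (K i) x) + (x - mean (K j) x)))\<^sup>2"
  shows energy_centroid_le: "energy K (centroid K x) \<le> (1 - (2 / \<rho> - 1) / 3) * energy K x"
    and dist_centroid_le: "dist x (centroid K x) \<le> sqrt (energy K x)"
proof -
  define u where "u i = x - mean (K i) x" for i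
  define s where "s = u 1 + u 2 + u 3"
  have c: "centroid K x = x - s /\<^sub>R 3"
  proof -
    have "x = (x + x + x) /\<^sub>R 3"
      by (simp add: scaleR_add_right flip: scaleR_add_left)
    then show ?thesis
      by (simp add: centroid_def s_def u_def algebra_simps flip: scaleR_add_left)
  qed
  have E: "energy K x = (norm (u 1))\<^sup>2 + (norm (u 2))\<^sup>2 + (norm (u 3))\<^sup>2"
    by (simp add: energy_def u_def)
  have le: "(norm (centroid K x - mean (K i) (centroid K x)))\<^sup>2 \<le> (norm (u i - s /\<^sub>R 3))\<^sup>2"
    if "i \<in> {1, 2, 3}" for i
  proof -
    \<comment> \<open>The old mean is still fixed by \<open>K i\<close>, so it is no nearer to the
      centroid than the new mean.\<close>
    have "norm (centroid K x - mean (K i) (centroid K x)) \<le> norm (centroid K x - mean (K i) x)"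
      using K fin that by (intro norm_diff_mean_le mean_in_fixed) auto
    also have "centroid K x - mean (K i) x = u i - s /\<^sub>R 3"
      by (simp add: c u_def)
    finally show ?thesis
      by (simp add: power_mono)
  qed
  have "energy K (centroid K x) \<le>
      (norm (u 1 - s /\<^sub>R 3))\<^sup>2 + (norm (u 2 - s /\<^sub>R 3))\<^sup>2 + (norm (u 3 - s /\<^sub>R 3))\<^sup>2"
    unfolding energy_def by (intro add_mono le) auto
  also have "\<dots> = energy K x - (norm s)\<^sup>2 / 3"
    unfolding E s_def by (rule sum3_norm_diff_third)
  finally have *: "energy K (centroid K x) \<le> energy K x - (norm s)\<^sup>2 / 3" .
  define d where "d = (2 / \<rho> - 1) * energy K x"
  have "d \<le> (norm s)\<^sup>2"
    unfolding d_def E s_def using pairs[of 1 2] pairs[of 1 3] pairs[of 2 3]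
    by (intro norm_sum3_ge) (auto simp: u_def)
  moreover have "(1 - (2 / \<rho> - 1) / 3) * energy K x = energy K x - d / 3"
    by (simp add: d_def left_diff_distrib)
  ultimately show "energy K (centroid K x) \<le> (1 - (2 / \<rho> - 1) / 3) * energy K x"
    using * by linarith
  have "dist x (centroid K x) = norm s / 3"
    by (simp add: c dist_norm)
  \<comment> \<open>The drop in energy cannot exceed the energy, as the new energy is nonnegative;
    this bounds the length of the step.\<close>
  also have "(norm s)\<^sup>2 / 3 \<le> energy K x"
    using * energy_nonneg[of K "centroid K x"] by simp
  then have "(norm s / 3)\<^sup>2 \<le> energy K x"
    using energy_nonneg[of K x] by (simp add: power_divide)
  then have "norm s / 3 \<le> sqrt (energy K x)"
    by (rule real_le_rsqrt)
  finally show "dist x (centroid K x) \<le> sqrt (energy K x)" .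
qed

lemma tendsto_mean:
  assumes "K \<subseteq> carrier G" "(x \<longlongrightarrow> l) S"
  shows "((\<lambda>n. mean K (x n)) \<longlongrightarrow> mean K l) S"
proof -
  have "((\<lambda>n. \<alpha> k (x n)) \<longlongrightarrow> \<alpha> k l) S" if "k \<in> K" for k
    using assms that by (subst tendsto_dist_iff) (simp add: dist_act subsetD flip: tendsto_dist_iff)
  then show ?thesis
    unfolding mean_def by (intro tendsto_intros)
qed

lemma fixed_generate:
  assumes "x \<in> fixed A" "A \<subseteq> carrier G" "g \<in> generate G A"
  shows "\<alpha> g x = x"
  using assms(3)
proof induction
  case (inv h)
  then show ?case
    using assms orbit_sym_aux[of h x x] by (auto simp: fixed_def)
next
  case (eng g h)
  then show ?case
    using assms(2) by (simp add: act_mult generate_in_carrier)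
qed (use assms in \<open>auto simp: fixed_def act_one\<close>)

text \<open>Starting from 0, the energies decay like \<open>q ^ n\<close> and the step lengths like
  \<open>sqrt q ^ n\<close>, so the iterates converge. The means are continuous, so the limit has
  energy zero and equals its own mean over each \<open>K i\<close>.\<close>

lemma ex_fixed_if_energy_contracts:
  fixes K :: "nat \<Rightarrow> 'g set"
  assumes complete: "\<And>x :: nat \<Rightarrow> 'h. Cauchy x \<Longrightarrow> convergent x"
    and K: "\<And>i. i \<in> {1, 2, 3} \<Longrightarrow> subgroup (K i) G" "\<And>i. i \<in> {1, 2, 3} \<Longrightarrow> finite (K i)"
    and q: "0 \<le> q" "q < 1" and contract: "\<And>x. energy K (centroid K x) \<le> q * energy K x"
    and move: "\<And>x. dist x (centroid K x) \<le> sqrt (energy K x)"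
  shows "\<exists>x. x \<in> fixed (K 1 \<union> K 2 \<union> K 3)"
proof -
  define x where "x n = (centroid K ^^ n) 0" for n
  have energy: "energy K (x n) \<le> energy K 0 * q ^ n" for n
  proof (induction n)
    case (Suc n)
    have "energy K (x (Suc n)) \<le> q * energy K (x n)"
      using contract[of "x n"] by (simp add: x_def)
    also have "\<dots> \<le> q * (energy K 0 * q ^ n)"
      using Suc q(1) by (rule mult_left_mono)
    finally show ?case
      by (simp add: mult_ac)
  qed (simp add: x_def)
  have "Cauchy x"
  proof (rule Cauchy_geometric)
    fix n
    have "dist (x n) (x (Suc n)) \<le> sqrt (energy K (x n))"
      using move[of "x n"] by (simp add: x_def)
    also have "\<dots> \<le> sqrt (energy K 0 * q ^ n)"
      using energy by simp
    finally show "dist (x n) (x (Suc n)) \<le> sqrt (energy K 0) * sqrt q ^ n"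
      by (simp add: real_sqrt_mult real_sqrt_power)
  qed (use q in auto)
  then obtain l where l: "x \<longlonglongrightarrow> l"
    using complete by (auto simp: convergent_def)
  have "(\<lambda>n. energy K (x n)) \<longlonglongrightarrow> energy K l"
    unfolding energy_def using K by (intro tendsto_intros tendsto_mean l) (auto dest: subgroup.subset)
  moreover have "(\<lambda>n. energy K 0 * q ^ n) \<longlonglongrightarrow> energy K 0 * 0"
    using q by (intro tendsto_intros LIMSEQ_power_zero) simp
  ultimately have "energy K l \<le> energy K 0 * 0"
    using energy by (intro LIMSEQ_le) auto
  then have "energy K l \<le> 0"
    by simp
  moreover have "(norm (l - mean (K i) l))\<^sup>2 \<le> energy K l" if "i \<in> {1, 2, 3}" for i
    using that by (auto simp: energy_def)
  ultimately have "(norm (l - mean (K i) l))\<^sup>2 \<le> 0" if "i \<in> {1, 2, 3}" for i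
    using that by (blast intro: order_trans)
  then have "l = mean (K i) l" if "i \<in> {1, 2, 3}" for i
    using that by simp
  then have "l \<in> fixed (K i)" if "i \<in> {1, 2, 3}" for i
    using that mean_in_fixed[of "K i" l] K by metis
  then show ?thesis
    by (auto simp: fixed_def intro!: exI[of _ l])
qed

end

section \<open>From the pair condition to the fixed point\<close>

text \<open>
  The Hilbert spaces of the pair condition are realised on subsets of \<open>'h\<close>, so a nonzero vector of
  \<open>'h\<close> is needed to have room for the regular representation.
\<close>
lemma pair_condition_uniform:
  fixes G (structure) and a :: "'h::real_vector"
  assumes "group G" "subgroup K G" "subgroup L G" "finite (generate G (K \<union> L))"
    and pair: "pair_condition G K L TYPE('h)" and "a \<noteq> 0"
  obtains \<rho> where "1 \<le> \<rho>" "\<rho> < 2"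
    "\<And>v. v \<in> supported (generate G (K \<union> L)) \<Longrightarrow> (\<Sum>g\<in>generate G (K \<union> L). v g) = 0 \<Longrightarrow>
      (\<Sum>g\<in>generate G (K \<union> L). (v g)\<^sup>2) \<le>
        \<rho> * (defect G (generate G (K \<union> L)) K v + defect G (generate G (K \<union> L)) L v)"
proof -
  interpret group G by fact
  let ?F = "generate G (K \<union> L)"
  obtain j :: "('a \<Rightarrow> real) \<Rightarrow> 'h" where "inj_on j (supported ?F)"
    using ex_inj_on_supported[of ?F a] assms by blast
  moreover have "subgroup ?F G"
    using assms(2,3) by (intro generate_is_subgroup) (auto dest: subgroup.subset)
  ultimately interpret finite_regular ?F j G
    using assms by (intro finite_regular.intro finite_l2.intro)
  show thesis
    by (rule uniform_defect_bound[OF assms(4)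
      sum_squares_less_defects[OF pair refl assms(2,3)] that])
qed

text \<open>The gain is uniformity: \<open>\<rho>\<close> is chosen before \<open>x\<close>, so one
  contraction factor serves the whole iteration.\<close>

lemma (in isometric_action) norm_add_displacements_ge_pair:
  fixes a :: 'h
  assumes K: "subgroup K G" and L: "subgroup L G" and fin: "finite (generate G (K \<union> L))"
    and pair: "pair_condition G K L TYPE('h)" and "a \<noteq> 0"
  obtains \<rho> where "1 \<le> \<rho>" "\<rho> < 2"
    "\<And>x. ((norm (x - mean K x))\<^sup>2 + (norm (x - mean L x))\<^sup>2) / \<rho> \<le>
      (norm ((x - mean K x) + (x - mean L x)))\<^sup>2"
proof -
  let ?F = "generate G (K \<union> L)"
  have F: "subgroup ?F G" "K \<subseteq> ?F" "L \<subseteq> ?F"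
    using K L by (auto intro!: generate_is_subgroup intro: generate.incl dest: subgroup.subset)
  obtain \<rho> where \<rho>: "1 \<le> \<rho>" "\<rho> < 2" and bound:
    "\<And>v. v \<in> supported ?F \<Longrightarrow> (\<Sum>g\<in>?F. v g) = 0 \<Longrightarrow>
      (\<Sum>g\<in>?F. (v g)\<^sup>2) \<le> \<rho> * (defect G ?F K v + defect G ?F L v)"
    using pair_condition_uniform[OF is_group K L fin pair \<open>a \<noteq> 0\<close>] by blast
  have "(norm (x - mean ?F x))\<^sup>2 \<le> \<rho> * ((norm (x - mean K x))\<^sup>2 + (norm (x - mean L x))\<^sup>2)" for x
    by (rule norm_diff_mean_le_pair[OF F(1) fin K F(2) L F(3)])
      (simp add: bound supported_def)
  then show thesis
    using \<rho> by (intro that[of \<rho>] norm_add_displacements_ge[OF F(1) fin K F(2) L F(3)]) auto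
qed

theorem theorem1p7:
  fixes G :: "('g, 'n) monoid_scheme" and K :: "nat \<Rightarrow> 'g set"
  assumes "group G"
    and "\<And>i. i \<in> {1, 2, 3} \<Longrightarrow> subgroup (K i) G"
    and "carrier G = generate G (K 1 \<union> K 2 \<union> K 3)"
    and "\<And>i j. i \<in> {1, 2, 3} \<Longrightarrow> j \<in> {1, 2, 3} \<Longrightarrow> i \<noteq> j \<Longrightarrow> finite (generate G (K i \<union> K j))"
    and "\<And>i j. i \<in> {1, 2, 3} \<Longrightarrow> j \<in> {1, 2, 3} \<Longrightarrow> i \<noteq> j \<Longrightarrow>
      pair_condition G (K i) (K j) TYPE('h::{real_inner, complete_space})"
  shows "property_FH G TYPE('h)"
  unfolding property_FH_def
proof (intro allI impI, elim conjE)
  fix \<alpha> :: "'g \<Rightarrow> 'h \<Rightarrow> 'h"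
  assume "group_action G UNIV \<alpha>" "\<forall>g\<in>carrier G. affine_isometry (\<alpha> g)"
  then interpret isometric_action G \<alpha>
    by (intro isometric_action.intro isometric_action_axioms.intro) auto
  show "\<exists>x. \<forall>g\<in>carrier G. \<alpha> g x = x"
  proof (cases "\<exists>a :: 'h. a \<noteq> 0")
    \<comment> \<open>In the zero space 0 is fixed by every map; the other case supplies the vector
      that the encoding requires.\<close>
    case False
    then have "x = 0" for x :: 'h
      by blast
    then show ?thesis
      by (intro exI[of _ 0] ballI)
  next
    case True
    then obtain a :: 'h where "a \<noteq> 0" ..
    define P where "P \<rho> i j \<longleftrightarrow> (\<forall>x. ((norm (x - mean (K i) x))\<^sup>2 + (norm (x - mean (K j) x))\<^sup>2) / \<rho> \<le>
      (norm ((x - mean (K i) x) + (x - mean (K j) x)))\<^sup>2)" for \<rho> i j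
    have "\<exists>\<rho>\<ge>1. \<rho> < 2 \<and> P \<rho> i j" if "i \<in> {1, 2, 3}" "j \<in> {1, 2, 3}" "i \<noteq> j" for i j
      by (rule norm_add_displacements_ge_pair[OF assms(2)[OF that(1)] assms(2)[OF that(2)]
        assms(4)[OF that] assms(5)[OF that] \<open>a \<noteq> 0\<close>]) (unfold P_def, blast)
    from this[of 1 2] this[of 1 3] this[of 2 3] obtain r s t where
      rst: "1 \<le> r" "r < 2" "P r 1 2" "1 \<le> s" "s < 2" "P s 1 3" "1 \<le> t" "t < 2" "P t 2 3"
      by auto
    \<comment> \<open>The lower bounds weaken as the constant grows, so the largest of the three
      serves all pairs and is still below 2.\<close>
    define \<rho> where "\<rho> = max r (max s t)"
    have \<rho>: "1 \<le> \<rho>" "\<rho> < 2"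
      using rst by (auto simp: \<rho>_def)
    have mono: "P \<rho> i j" if "P q i j" "1 \<le> q" "q \<le> \<rho>" for q i j
      unfolding P_def
    proof
      fix x
      let ?d = "(norm (x - mean (K i) x))\<^sup>2 + (norm (x - mean (K j) x))\<^sup>2"
      have "?d / \<rho> \<le> ?d / q"
        using that by (intro divide_left_mono) auto
      also have "\<dots> \<le> (norm ((x - mean (K i) x) + (x - mean (K j) x)))\<^sup>2"
        using that(1) by (simp only: P_def)
      finally show "?d / \<rho> \<le> (norm ((x - mean (K i) x) + (x - mean (K j) x)))\<^sup>2" .
    qed
    have pairs: "P \<rho> i j" if "(i, j) \<in> {(1, 2), (1, 3), (2, 3)}" for i j
      using that mono[OF rst(3,1)] mono[OF rst(6,4)] mono[OF rst(9,7)] by (auto simp: \<rho>_def)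
    have fin: "finite (K i)" if "i \<in> {1, 2, 3}" for i
    proof -
      \<comment> \<open>Any index other than \<open>i\<close> gives a finite group containing
        \<open>K i\<close>.\<close>
      have "finite (generate G (K i \<union> K (if i = 1 then 2 else 1)))"
        using that by (intro assms(4)) auto
      then show ?thesis
        by (rule rev_finite_subset) (auto intro: generate.incl)
    qed
    have "\<exists>x. x \<in> fixed (K 1 \<union> K 2 \<union> K 3)"
    proof (rule ex_fixed_if_energy_contracts)
      show "convergent x" if "Cauchy x" for x :: "nat \<Rightarrow> 'h"
        using that by (rule Cauchy_convergent)
      show "energy K (centroid K x) \<le> (1 - (2 / \<rho> - 1) / 3) * energy K x" for x
        using pairs by (intro energy_centroid_le assms fin) (auto simp: P_def)
      show "dist x (centroid K x) \<le> sqrt (energy K x)" for x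
        using pairs by (intro dist_centroid_le[where \<rho> = \<rho>] assms fin) (auto simp: P_def)
      \<comment> \<open>For \<open>1 \<le> \<rho>\<close> and \<open>\<rho> < 2\<close> this factor
        is at least 2/3 and less than 1.\<close>
      show "0 \<le> 1 - (2 / \<rho> - 1) / 3" "1 - (2 / \<rho> - 1) / 3 < 1"
        using \<rho> by (auto simp: field_simps)
    qed (use assms fin in auto)
    then obtain x where "x \<in> fixed (K 1 \<union> K 2 \<union> K 3)" ..
    moreover have "K 1 \<union> K 2 \<union> K 3 \<subseteq> carrier G"
      using assms(2) by (auto dest: subgroup.subset)
    ultimately have "\<alpha> g x = x" if "g \<in> carrier G" for g
      by (rule fixed_generate[OF _ _ that[unfolded assms(3)]])
    then show ?thesis
      by blast
  qed
qed

end
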